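(* Let $D\subset\mathbb{R}^d$ be a compact set with $D=\overline{D^\circ}$ and $\mu_d(\partial D)=0$. Let $\mathcal{F}=\{f_1,\ldots,f_k\}$ be an iterated function system of injective contractions on $\mathbb{R}^d$, whose attractor $E$ satisfies $\mu_d(E)=0$. Put $\Phi(S)=\bigcup_{i=1}^k f_i(S)$ for $S\subset\mathbb{R}^d$. Suppose that there exists some $Y\subset D$ satisfying the following conditions: (1) $\overline{Y^\circ}=Y$ and $\mu_d(\partial Y)=0$; (2) $Y,f_1(Y),\ldots,f_k(Y)$ are subsets of $D$ which are mutually disjoint in measure; (3) $Y,f_1\big(D\setminus\Phi(Y)\big),\ldots,f_k\big(D\setminus\Phi(Y)\big)$ are subsets of $D$ which are mutually disjoint in measure. Then $D$ admits a dissection with respect to $\mathcal{F}$.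
   Context: $\mu_d$ is $d$-dimensional Lebesgue measure; $X^\circ,\overline X,\partial X$ denote interior, closure and boundary. Sets are mutually disjoint in measure if the intersection of any two of them (with different positions in the list) has $\mu_d$-measure $0$. An iterated function system (IFS) is a finite family $\mathcal{F}=\{f_1,\ldots,f_k\}$ of contractions $\mathbb{R}^d\to\mathbb{R}^d$; its attractor is the unique nonempty compact set $E$ with $E=\bigcup_{i=1}^k f_i(E)$. $D$ admits a dissection with respect to $\mathcal{F}=\{f_1,\ldots,f_k\}$ (the $f_i$ injective) if there exists a compact set $X\subset\mathbb{R}^d$ with $\overline{X^\circ}=X$ such that $D=X\cup f_1(X)\cup\cdots\cup f_k(X)$, where $\mu_d(f_i(X)\cap f_j(X))=0$ for all distinct $i,j\in\{1,\ldots,k\}$ and $\mu_d(X\cap f_i(X))=0$ for each $i\in\{1,\ldots,k\}$. *)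

theory Defs
  imports "HOL-Analysis.Analysis"
begin

definition contraction :: "('a::metric_space \<Rightarrow> 'a) \<Rightarrow> bool" where
  "contraction g \<longleftrightarrow> (\<exists>c<1. c-lipschitz_on UNIV g)"

text \<open>An iterated function system is a family indexed by \<open>1, \<dots>, k\<close>; the values of \<open>f\<close> at other
  indices are irrelevant. Repetitions are allowed, and the family is nonempty.\<close>

definition ifs :: "nat \<Rightarrow> (nat \<Rightarrow> 'a::metric_space \<Rightarrow> 'a) \<Rightarrow> bool" where
  "ifs k f \<longleftrightarrow> 1 \<le> k \<and> (\<forall>i\<in>{1..k}. contraction (f i))"

definition ifs_image :: "nat \<Rightarrow> (nat \<Rightarrow> 'a \<Rightarrow> 'a) \<Rightarrow> 'a set \<Rightarrow> 'a set" where
  "ifs_image k f S = (\<Union>i\<in>{1..k}. f i ` S)"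

definition attractor :: "nat \<Rightarrow> (nat \<Rightarrow> 'a::metric_space \<Rightarrow> 'a) \<Rightarrow> 'a set" where
  "attractor k f = (THE E. E \<noteq> {} \<and> compact E \<and> E = ifs_image k f E)"

text \<open>Membership in \<open>null_sets\<close> also requires measurability; \<open>emeasure\<close> alone would be \<open>0\<close>
  on every nonmeasurable set.\<close>

definition mutually_disjoint_in_measure :: "'a::euclidean_space set list \<Rightarrow> bool" where
  "mutually_disjoint_in_measure Ss \<longleftrightarrow>
     (\<forall>i<length Ss. \<forall>j<length Ss. i \<noteq> j \<longrightarrow> Ss ! i \<inter> Ss ! j \<in> null_sets lebesgue)"

definition admits_dissection ::
    "'a::euclidean_space set \<Rightarrow> nat \<Rightarrow> (nat \<Rightarrow> 'a \<Rightarrow> 'a) \<Rightarrow> bool" where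
  "admits_dissection D k f \<longleftrightarrow>
     (\<exists>X. compact X \<and> closure (interior X) = X \<and>
          D = X \<union> (\<Union>i\<in>{1..k}. f i ` X) \<and>
          (\<forall>i\<in>{1..k}. \<forall>j\<in>{1..k}. i \<noteq> j \<longrightarrow> f i ` X \<inter> f j ` X \<in> null_sets lebesgue) \<and>
          (\<forall>i\<in>{1..k}. X \<inter> f i ` X \<in> null_sets lebesgue))"

text \<open>The description in the definition of \<^const>\<open>attractor\<close> is proper (Hutchinson's theorem).\<close>

lemma ifs_uniform_constant:
  assumes "ifs k f"
  obtains c where "0 \<le> c" "c < 1" "\<And>i x y. i \<in> {1..k} \<Longrightarrow> dist (f i x) (f i y) \<le> c * dist x y"
proof -
  have "\<forall>i\<in>{1..k}. \<exists>c. c < 1 \<and> c-lipschitz_on UNIV (f i)"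
    using assms unfolding ifs_def contraction_def by blast
  then obtain C where C: "\<And>i. i \<in> {1..k} \<Longrightarrow> C i < 1 \<and> (C i)-lipschitz_on UNIV (f i)"
    by (metis (no_types))
  define c where "c = Max (C ` {1..k})"
  have ne: "{1..k} \<noteq> {}" using assms by (auto simp: ifs_def)
  have le: "C i \<le> c" if "i \<in> {1..k}" for i
    unfolding c_def using that by (intro Max_ge) auto
  have "c \<in> C ` {1..k}" unfolding c_def using ne by (intro Max_in) auto
  then have c: "0 \<le> c" "c < 1" using C lipschitz_on_nonneg by blast+
  have "dist (f i x) (f i y) \<le> c * dist x y" if "i \<in> {1..k}" for i x y
  proof -
    have "dist (f i x) (f i y) \<le> C i * dist x y"
      using C[OF that] by (auto dest: lipschitz_onD)
    also have "\<dots> \<le> c * dist x y" using le[OF that] by (intro mult_right_mono) auto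
    finally show ?thesis .
  qed
  with c show ?thesis using that by blast
qed

lemma ifs_continuous_on:
  assumes "ifs k f" "i \<in> {1..k}"
  shows "continuous_on S (f i)"
  using assms unfolding ifs_def contraction_def
  by (meson continuous_on_subset lipschitz_on_continuous_on subset_UNIV)

lemma attractor_subset:
  fixes f :: "nat \<Rightarrow> 'a::{heine_borel,real_normed_vector} \<Rightarrow> 'a"
  assumes "ifs k f"
    and E: "E \<noteq> {}" "compact E" "E = ifs_image k f E"
    and F: "F \<noteq> {}" "compact F" "F = ifs_image k f F"
  shows "E \<subseteq> F"
proof -
  obtain c where c: "0 \<le> c" "c < 1"
    "\<And>i x y. i \<in> {1..k} \<Longrightarrow> dist (f i x) (f i y) \<le> c * dist x y"
    using ifs_uniform_constant[OF assms(1)] by blast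
  have "continuous_on E (\<lambda>x. infdist x F)" by (intro continuous_intros)
  then obtain x where x: "x \<in> E" "\<And>y. y \<in> E \<Longrightarrow> infdist y F \<le> infdist x F"
    using continuous_attains_sup[OF E(2,1)] by blast
  obtain i y where i: "i \<in> {1..k}" "y \<in> E" "x = f i y"
    using x(1) E(3) unfolding ifs_image_def by blast
  obtain y' where y': "y' \<in> F" "infdist y F = dist y y'"
    using infdist_attains_inf[OF compact_imp_closed[OF F(2)] F(1)] by blast
  have "f i y' \<in> F" using y'(1) i(1) F(3) unfolding ifs_image_def by blast
  then have "infdist x F \<le> dist (f i y) (f i y')" unfolding i(3) by (rule infdist_le)
  also have "\<dots> \<le> c * infdist y F" using c(3)[OF i(1)] y'(2) by simp
  also have "\<dots> \<le> c * infdist x F" using x(2)[OF i(2)] c(1) by (intro mult_left_mono)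
  finally have "(1 - c) * infdist x F \<le> 0" by (simp add: algebra_simps)
  then have "infdist x F \<le> 0" using c(2) by (simp add: mult_le_0_iff)
  then have "infdist z F = 0" if "z \<in> E" for z
    using x(2)[OF that] infdist_nonneg[of z F] by linarith
  then show ?thesis
    using in_closed_iff_infdist_zero[OF compact_imp_closed[OF F(2)] F(1)] by blast
qed

lemma ex_attractor:
  fixes f :: "nat \<Rightarrow> 'a::{heine_borel,real_normed_vector} \<Rightarrow> 'a"
  assumes ifs: "ifs k f"
  shows "\<exists>E. E \<noteq> {} \<and> compact E \<and> E = ifs_image k f E"
proof -
  obtain c where c: "0 \<le> c" "c < 1"
    "\<And>i x y. i \<in> {1..k} \<Longrightarrow> dist (f i x) (f i y) \<le> c * dist x y"
    using ifs_uniform_constant[OF ifs] by blast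
  have one: "1 \<in> {1..k}" using ifs by (auto simp: ifs_def)
  define M where "M = (\<Sum>i\<in>{1..k}. norm (f i 0))"
  define R where "R = M / (1 - c)"
  have M0: "0 \<le> M" unfolding M_def by (intro sum_nonneg) auto
  have M: "norm (f i 0) \<le> M" if "i \<in> {1..k}" for i
    unfolding M_def using that by (intro member_le_sum) auto
  have R0: "0 \<le> R" using M0 c by (simp add: R_def)
  have R: "c * R + M = R" using c(2) by (simp add: R_def field_simps)
  define K where "K n = (ifs_image k f ^^ n) (cball 0 R)" for n
  have KS: "K (Suc n) = ifs_image k f (K n)" for n by (simp add: K_def)
  have mono: "ifs_image k f A \<subseteq> ifs_image k f B" if "A \<subseteq> B" for A B
    using that unfolding ifs_image_def by blast
  have "K (Suc 0) \<subseteq> K 0"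
  proof
    fix z assume "z \<in> K (Suc 0)"
    then obtain i x where ix: "i \<in> {1..k}" "norm x \<le> R" "z = f i x"
      by (auto simp: K_def ifs_image_def)
    have "norm (f i x) \<le> dist (f i x) (f i 0) + norm (f i 0)"
      by (metis dist_norm norm_triangle_sub add.commute)
    also have "\<dots> \<le> c * R + M"
      using c(3)[OF ix(1), of x 0] mult_left_mono[OF ix(2) c(1)] M[OF ix(1)] by simp
    finally show "z \<in> K 0" by (simp add: K_def R ix(3))
  qed
  then have dec1: "K (Suc n) \<subseteq> K n" for n
    by (induction n) (use mono KS in auto)
  have dec: "K n \<subseteq> K m" if "m \<le> n" for m n
    using lift_Suc_antimono_le[of K, OF dec1 that] .
  have cpt: "compact (K n)" for n
  proof (induction n)
    case (Suc n)
    show ?case unfolding KS ifs_image_def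
      using Suc ifs_continuous_on[OF ifs] by (intro compact_UN compact_continuous_image) auto
  qed (simp add: K_def)
  have ne: "K n \<noteq> {}" for n
  proof (induction n)
    case (Suc n)
    then show ?case unfolding KS ifs_image_def using one by blast
  qed (use R0 in \<open>simp add: K_def\<close>)
  define E where "E = \<Inter>(range K)"
  have Ene: "E \<noteq> {}" unfolding E_def by (intro compact_nest cpt ne dec)
  have Ecpt: "compact E" unfolding E_def by (intro compact_Inter) (auto simp: cpt)
  have "ifs_image k f E \<subseteq> K n" for n
  proof -
    have "ifs_image k f E \<subseteq> ifs_image k f (K n)" by (rule mono) (auto simp: E_def)
    then show ?thesis using dec1[of n] KS by blast
  qed
  then have sub: "ifs_image k f E \<subseteq> E" by (auto simp: E_def)
  have "E \<subseteq> ifs_image k f E"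
  proof
    fix x assume x: "x \<in> E"
    have "\<exists>i\<in>{1..k}. \<forall>n. x \<in> f i ` K n"
    proof (rule ccontr)
      assume "\<not> ?thesis"
      then obtain N where N: "\<And>i. i \<in> {1..k} \<Longrightarrow> x \<notin> f i ` K (N i)" by metis
      define m where "m = Max (N ` {1..k})"
      have "N i \<le> m" if "i \<in> {1..k}" for i
        unfolding m_def using that by (intro Max_ge) auto
      then have "x \<notin> f i ` K m" if "i \<in> {1..k}" for i
        using N[OF that] dec that by blast
      then have "x \<notin> K (Suc m)" unfolding KS ifs_image_def by blast
      then show False using x unfolding E_def by blast
    qed
    then obtain i where i: "i \<in> {1..k}" "\<And>n. x \<in> f i ` K n" by blast
    define L where "L n = K n \<inter> f i -` {x}" for n
    have clos: "closed (f i -` {x})"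
      using ifs_continuous_on[OF ifs i(1), of UNIV] by (intro closed_vimage) auto
    have "\<Inter>(range L) \<noteq> {}"
    proof (rule compact_nest)
      show "compact (L n)" for n unfolding L_def using cpt clos by (rule compact_Int_closed)
      show "L n \<noteq> {}" for n using i(2)[of n] unfolding L_def by blast
      show "L n \<subseteq> L m" if "m \<le> n" for m n using dec[OF that] unfolding L_def by blast
    qed
    then obtain y where "\<And>n. y \<in> K n" "f i y = x" unfolding L_def by blast
    then show "x \<in> ifs_image k f E" using i(1) unfolding ifs_image_def E_def by blast
  qed
  with sub Ene Ecpt show ?thesis by blast
qed

theorem attractor_unique_existence:
  fixes f :: "nat \<Rightarrow> 'a::{heine_borel,real_normed_vector} \<Rightarrow> 'a"
  assumes "ifs k f"
  shows "\<exists>!E. E \<noteq> {} \<and> compact E \<and> E = ifs_image k f E"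
proof -
  obtain E where E: "E \<noteq> {} \<and> compact E \<and> E = ifs_image k f E"
    using ex_attractor[OF assms] by blast
  show ?thesis
  proof (rule ex1I[of _ E])
    show "F = E" if "F \<noteq> {} \<and> compact F \<and> F = ifs_image k f F" for F
      using attractor_subset[OF assms, of E F] attractor_subset[OF assms, of F E] E that by blast
  qed (rule E)
qed

end

theory Submission imports Defs begin

text \<open>
  A dissection asks for a set \<open>X\<close> that is, up to null sets, a fixed point of the antitone map
  \<open>S \<mapsto> D - \<Phi>(S)\<close>. To control boundaries, the map is replaced by its regularised version
  \<open>\<theta>(S) = D\<degree> - \<Phi>(cl S)\<close>, whose values are open. Two open sets whose intersection is null are
  disjoint, so the two hypotheses on \<open>Y\<close> become exact inclusions: for \<open>U\<^sub>0 = Y\<degree>\<close> they give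
  \<open>U\<^sub>0 \<subseteq> \<theta>(U\<^sub>0)\<close> and \<open>U\<^sub>0 \<subseteq> \<theta>(\<theta>(U\<^sub>0))\<close>. Hence the even iterates \<open>U\<^sub>n\<close> of \<open>U\<^sub>0\<close> under \<open>\<theta>\<close>
  increase, the odd iterates \<open>V\<^sub>n\<close> decrease, and every \<open>U\<^sub>n\<close> lies in every \<open>V\<^sub>m\<close>. The dissecting set is
  \<open>X = cl P\<close> with \<open>P = \<Union>\<^sub>n U\<^sub>n\<close>.

  What has to be shown is that no mass remains between the two limits, that is, that
  \<open>W = (\<Inter>\<^sub>n cl V\<^sub>n) - P\<close> is null. By invariance of domain the injective contractions carry boundaries
  to boundaries, and they preserve null sets, so all \<open>\<partial>V\<^sub>n\<close> are null. Away from these boundaries a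
  point of \<open>W\<close> lies in \<open>\<Phi>(cl V\<^sub>n)\<close> for all \<open>n\<close>, because it is not in \<open>U\<^sub>n\<^sub>+\<^sub>1\<close>, and in no \<open>\<Phi>(U\<^sub>n)\<close>; so it
  is the image of a point of \<open>W\<close>. Thus \<open>W\<close> is almost covered by \<open>\<Phi>(W)\<close>. Following preimages
  backwards for ever inside a bounded set is only possible on the attractor, and so \<open>W\<close> is null
  (\<open>negligible_if_almost_self_covered\<close>).

  Everything else follows. The open set \<open>D\<degree> - (X \<union> \<Phi>(X))\<close> lies in \<open>W\<close>, so it is empty and the
  pieces cover \<open>D\<close>; and \<open>X - P\<close> also lies in \<open>W\<close>, so the exactly disjoint open pieces \<open>P\<close>, \<open>f\<^sub>i(P)\<close>
  have closures that overlap in null sets only.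
\<close>

section \<open>Images under an iterated function system\<close>

lemma ifs_image_mono: "A \<subseteq> B \<Longrightarrow> ifs_image k f A \<subseteq> ifs_image k f B"
  unfolding ifs_image_def by blast

lemma ifs_image_INT_decseq:
  assumes inj: "\<forall>i\<in>{1..k}. inj (f i)" and "decseq C"
  shows "(\<Inter>n. ifs_image k f (C n)) \<subseteq> ifs_image k f (\<Inter>n. C n)"
proof
  fix x assume x: "x \<in> (\<Inter>n. ifs_image k f (C n))"
  \<comment> \<open>One index serves all \<open>n\<close>: otherwise every index fails from some point on.\<close>
  have "\<exists>i\<in>{1..k}. \<forall>n. x \<in> f i ` C n"
  proof (rule ccontr)
    assume "\<not> ?thesis"
    then obtain N where N: "\<And>i. i \<in> {1..k} \<Longrightarrow> x \<notin> f i ` C (N i)" by metis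
    define m where "m = Max (N ` {1..k})"
    have "N i \<le> m" if "i \<in> {1..k}" for i
      unfolding m_def using that by (intro Max_ge) auto
    then have "x \<notin> f i ` C m" if "i \<in> {1..k}" for i
      using N[OF that] decseqD[OF \<open>decseq C\<close>] that by blast
    then show False using x unfolding ifs_image_def by blast
  qed
  then obtain i where i: "i \<in> {1..k}" "\<And>n. x \<in> f i ` C n" by blast
  then have "x \<in> (\<Inter>n. f i ` C n)" by blast
  also have "\<dots> = f i ` (\<Inter>n. C n)"
    using image_INT[of "f i" UNIV UNIV C 0] inj i(1) by auto
  finally show "x \<in> ifs_image k f (\<Inter>n. C n)"
    using i(1) unfolding ifs_image_def by blast
qed

lemma compact_ifs_image:
  assumes "ifs k f" "compact S"
  shows "compact (ifs_image k f S)"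
  unfolding ifs_image_def using assms(2) ifs_continuous_on[OF assms(1)]
  by (intro compact_UN finite_atLeastAtMost compact_continuous_image)

lemma negligible_ifs_map_image:
  fixes f :: "nat \<Rightarrow> 'a::euclidean_space \<Rightarrow> 'a"
  assumes "ifs k f" "i \<in> {1..k}" "negligible S"
  shows "negligible (f i ` S)"
proof (rule negligible_locally_Lipschitz_image)
  obtain c where c: "\<And>i x y. i \<in> {1..k} \<Longrightarrow> dist (f i x) (f i y) \<le> c * dist x y"
    using ifs_uniform_constant[OF assms(1)] by metis
  show "\<exists>T B. open T \<and> x \<in> T \<and> (\<forall>y\<in>S \<inter> T. norm (f i y - f i x) \<le> B * norm (y - x))" for x
    using c[OF assms(2)] by (intro exI[of _ UNIV] exI[of _ c]) (simp add: dist_norm)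
qed (use assms in auto)

lemma negligible_ifs_image:
  fixes f :: "nat \<Rightarrow> 'a::euclidean_space \<Rightarrow> 'a"
  assumes "ifs k f" "negligible S"
  shows "negligible (ifs_image k f S)"
  unfolding ifs_image_def using negligible_ifs_map_image[OF assms(1) _ assms(2)]
  by (intro negligible_Union) auto

section \<open>Sets covered by their own images\<close>

text \<open>The maps shrink the distance to the attractor by a factor \<open>c < 1\<close>, and every point of \<open>S\<close> is
  reached in arbitrarily many steps from points of \<open>S\<close>, whose distances are bounded.\<close>

lemma self_covered_subset_attractor:
  fixes f :: "nat \<Rightarrow> 'a::{heine_borel,real_normed_vector} \<Rightarrow> 'a"
  assumes ifs: "ifs k f" and "bounded S" and S: "S \<subseteq> ifs_image k f S"
  shows "S \<subseteq> attractor k f"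
proof
  define E where "E = attractor k f"
  have E: "E \<noteq> {}" "compact E" "E = ifs_image k f E"
    using theI'[OF attractor_unique_existence[OF ifs], folded attractor_def, folded E_def]
    by (blast, blast, simp)
  obtain c where c: "0 \<le> c" "c < 1"
    "\<And>i x y. i \<in> {1..k} \<Longrightarrow> dist (f i x) (f i y) \<le> c * dist x y"
    using ifs_uniform_constant[OF ifs] by blast
  obtain e where e: "e \<in> E" using E(1) by blast
  obtain B where B: "\<And>x. x \<in> S \<Longrightarrow> dist e x \<le> B"
    using \<open>bounded S\<close> bounded_any_center[of S e] by blast
  have contract: "infdist (f i y) E \<le> c * infdist y E" if i: "i \<in> {1..k}" for i y
  proof -
    obtain z where z: "z \<in> E" "infdist y E = dist y z"
      using infdist_attains_inf[OF compact_imp_closed[OF E(2)] E(1)] by blast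
    have "f i z \<in> E" using z(1) i by (subst E(3)) (auto simp: ifs_image_def)
    then have "infdist (f i y) E \<le> dist (f i y) (f i z)" by (rule infdist_le)
    also have "\<dots> \<le> c * infdist y E" using c(3)[OF i] z(2) by simp
    finally show ?thesis .
  qed
  have bound: "infdist x E \<le> c ^ n * B" if "x \<in> S" for x n
    using that
  proof (induction n arbitrary: x)
    case 0
    then show ?case using infdist_le[OF e, of x] B[of x] by (simp add: dist_commute)
  next
    case (Suc n)
    then obtain i y where iy: "i \<in> {1..k}" "y \<in> S" "x = f i y"
      using S unfolding ifs_image_def by blast
    have "infdist x E \<le> c * infdist y E" using contract iy by blast
    also have "\<dots> \<le> c * (c ^ n * B)" using Suc.IH[OF iy(2)] c(1) by (rule mult_left_mono)
    finally show ?case by (simp add: mult.assoc)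
  qed
  fix x assume x: "x \<in> S"
  have "(\<lambda>n. c ^ n * B) \<longlonglongrightarrow> 0 * B"
    using c by (intro tendsto_mult LIMSEQ_power_zero) auto
  then have "infdist x E \<le> 0 * B"
    by (rule LIMSEQ_le_const) (use bound[OF x] in blast)
  then have "infdist x E = 0" using infdist_nonneg[of x E] by simp
  then show "x \<in> attractor k f"
    using in_closed_iff_infdist_zero[OF compact_imp_closed[OF E(2)] E(1)] unfolding E_def by blast
qed

text \<open>The exceptional set \<open>N\<close> is enlarged to its forward orbit, which is still null. Outside the
  orbit a point of \<open>S\<close> can only come from a point of \<open>S\<close> outside the orbit, so the rest of \<open>S\<close>
  is covered by its own image.\<close>

lemma negligible_if_almost_self_covered:
  fixes f :: "nat \<Rightarrow> 'a::euclidean_space \<Rightarrow> 'a"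
  assumes ifs: "ifs k f" and "negligible (attractor k f)" and "bounded S"
    and "negligible N" and S: "S \<subseteq> ifs_image k f S \<union> ifs_image k f N \<union> N"
  shows "negligible S"
proof -
  define M where "M = (\<Union>n. (ifs_image k f ^^ n) N)"
  have "negligible ((ifs_image k f ^^ n) N)" for n
    by (induction n) (auto simp: \<open>negligible N\<close> negligible_ifs_image[OF ifs])
  then have "negligible M" unfolding M_def by (intro negligible_countable_Union) auto
  have "(ifs_image k f ^^ 0) N \<subseteq> M" unfolding M_def by blast
  then have "N \<subseteq> M" by simp
  have "ifs_image k f M \<subseteq> (\<Union>n. (ifs_image k f ^^ Suc n) N)"
    unfolding M_def ifs_image_def by auto
  also have "\<dots> \<subseteq> M" unfolding M_def by blast
  finally have M: "ifs_image k f M \<subseteq> M" .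
  have "S - M \<subseteq> ifs_image k f (S - M)"
  proof
    fix x assume x: "x \<in> S - M"
    have "ifs_image k f N \<subseteq> M" using ifs_image_mono[OF \<open>N \<subseteq> M\<close>] M by blast
    then have "x \<in> ifs_image k f S" using x S \<open>N \<subseteq> M\<close> by blast
    then show "x \<in> ifs_image k f (S - M)" using x M unfolding ifs_image_def by blast
  qed
  then have "S - M \<subseteq> attractor k f"
    using \<open>bounded S\<close> by (intro self_covered_subset_attractor[OF ifs]) (auto intro: bounded_subset)
  then have "S \<subseteq> attractor k f \<union> M" by blast
  then show ?thesis
    using \<open>negligible (attractor k f)\<close> \<open>negligible M\<close> negligible_Un negligible_subset by blast
qed

section \<open>Open sets and boundaries under injective continuous maps\<close>

text \<open>This turns the disjointness in measure of the pieces into honest disjointness: a nonempty open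
  set has positive measure.\<close>

lemma open_disjoint_if_null:
  fixes A B :: "'a::euclidean_space set"
  assumes "open A" "open B" "A \<inter> B \<subseteq> S" "S \<in> null_sets lebesgue"
  shows "A \<inter> B = {}"
  using assms open_not_negligible[of "A \<inter> B"] negligible_subset[of S "A \<inter> B"]
  by (auto simp: negligible_iff_null_sets)

lemma open_disjoint_image_closure:
  assumes "open A" "continuous_on UNIV g" "A \<inter> g ` S = {}"
  shows "A \<inter> g ` closure S = {}"
proof -
  have "g ` closure S \<subseteq> closure (g ` S)"
    by (intro image_closure_subset continuous_on_subset[OF assms(2)] closure_subset) auto
  then show ?thesis using assms(1,3) open_Int_closure_eq_empty[of A "g ` S"] by blast
qed

text \<open>By invariance of domain, \<open>g ` U\<close> is open and so misses the frontier.\<close>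

lemma frontier_image_closure_subset:
  fixes g :: "'a::euclidean_space \<Rightarrow> 'a"
  assumes g: "continuous_on UNIV g" "inj g" and U: "open U" "bounded U"
  shows "frontier (g ` closure U) \<subseteq> g ` frontier U"
proof -
  have "compact (g ` closure U)"
    using U(2) by (intro compact_continuous_image continuous_on_subset[OF g(1)]) auto
  then have clo: "closure (g ` closure U) = g ` closure U"
    by (simp add: compact_imp_closed)
  have "open (g ` U)"
    using g U(1) by (intro invariance_of_domain) (auto intro: continuous_on_subset inj_on_subset)
  then have "g ` U \<subseteq> interior (g ` closure U)"
    by (intro interior_maximal image_mono closure_subset)
  then show ?thesis
    unfolding frontier_def[of "g ` closure U"] clo frontier_def[of U] interior_open[OF U(1)] by blast
qed

section \<open>The regularised complement of the image\<close>

text \<open>Taking the interior of \<open>D\<close> and the closure of \<open>S\<close> makes the values open for bounded \<open>S\<close>; it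
  changes \<open>D - \<Phi>(S)\<close> only by points of \<open>\<partial>D\<close> and of \<open>\<Phi>(\<partial>S)\<close>.\<close>

definition open_complement :: "'a::topological_space set \<Rightarrow> nat \<Rightarrow> (nat \<Rightarrow> 'a \<Rightarrow> 'a) \<Rightarrow> 'a set \<Rightarrow> 'a set"
  where "open_complement D k f S = interior D - ifs_image k f (closure S)"

lemma open_complement_antimono:
  "S \<subseteq> T \<Longrightarrow> open_complement D k f T \<subseteq> open_complement D k f S"
  unfolding open_complement_def using ifs_image_mono[OF closure_mono] by blast

lemma open_complement_subset: "open_complement D k f S \<subseteq> interior D"
  unfolding open_complement_def by blast

lemma open_open_complement:
  fixes D :: "'a::euclidean_space set"
  assumes "ifs k f" "bounded S"
  shows "open (open_complement D k f S)"
  unfolding open_complement_def using compact_ifs_image[OF assms(1)] assms(2)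
  by (intro open_Diff compact_imp_closed) auto

lemma subset_open_complement:
  fixes D :: "'a::euclidean_space set"
  assumes "ifs k f" "open A" "A \<subseteq> interior D" "\<And>i. i \<in> {1..k} \<Longrightarrow> A \<inter> f i ` S = {}"
  shows "A \<subseteq> open_complement D k f S"
  using assms(3) open_disjoint_image_closure[OF assms(2) ifs_continuous_on[OF assms(1)] assms(4)]
  unfolding open_complement_def ifs_image_def by blast

lemma negligible_frontier_open_complement:
  fixes D :: "'a::euclidean_space set"
  assumes ifs: "ifs k f" and inj: "\<forall>i\<in>{1..k}. inj (f i)"
    and D: "negligible (frontier D)"
    and U: "open U" "bounded U" "negligible (frontier U)"
  shows "negligible (frontier (open_complement D k f U))"
proof (rule negligible_subset)
  show "negligible (frontier D \<union> ifs_image k f (frontier U))"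
    using D U(3) negligible_ifs_image[OF ifs] by (intro negligible_Un)
  have "frontier (ifs_image k f (closure U)) \<subseteq> (\<Union>i\<in>{1..k}. frontier (f i ` closure U))"
    unfolding ifs_image_def
    using frontier_Union_subset[of "(\<lambda>i. f i ` closure U) ` {1..k}"] by auto
  also have "\<dots> \<subseteq> ifs_image k f (frontier U)"
    unfolding ifs_image_def
    using frontier_image_closure_subset[OF ifs_continuous_on[OF ifs] _ U(1,2)] inj by blast
  finally have "frontier (ifs_image k f (closure U)) \<subseteq> ifs_image k f (frontier U)" .
  then show "frontier (open_complement D k f U) \<subseteq> frontier D \<union> ifs_image k f (frontier U)"
    using frontier_Int_subset[of "interior D" "- ifs_image k f (closure U)"]
      frontier_interior_subset[of D]
    unfolding open_complement_def Diff_eq frontier_complement by blast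
qed

section \<open>The dissection\<close>

lemma mutually_disjoint_in_measure_Cons_mapD:
  assumes "mutually_disjoint_in_measure (A # map g [1..<Suc k])"
  shows "\<And>i. i \<in> {1..k} \<Longrightarrow> A \<inter> g i \<in> null_sets lebesgue"
    and "\<And>i j. i \<in> {1..k} \<Longrightarrow> j \<in> {1..k} \<Longrightarrow> i \<noteq> j \<Longrightarrow> g i \<inter> g j \<in> null_sets lebesgue"
proof -
  let ?L = "A # map g [1..<Suc k]"
  have len: "length ?L = Suc k" by simp
  have nth: "?L ! i = g i" if "i \<in> {1..k}" for i
    using that by (cases i) (auto simp del: upt_Suc)
  have *: "?L ! i \<inter> ?L ! j \<in> null_sets lebesgue" if "i \<le> k" "j \<le> k" "i \<noteq> j" for i j
    using assms that unfolding mutually_disjoint_in_measure_def len by simp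
  show "A \<inter> g i \<in> null_sets lebesgue" if "i \<in> {1..k}" for i
    using *[of 0 i] nth[OF that] that by simp
  show "g i \<inter> g j \<in> null_sets lebesgue" if "i \<in> {1..k}" "j \<in> {1..k}" "i \<noteq> j" for i j
    using *[of i j] nth that by simp
qed

theorem theorem3p1:
  fixes D Y :: "(real ^ 'd) set"
    and f :: "nat \<Rightarrow> real ^ 'd \<Rightarrow> real ^ 'd"
    and k :: nat
  assumes "compact D"
    and "D = closure (interior D)"
    and "frontier D \<in> null_sets lebesgue"
    and "ifs k f"
    and "\<forall>i\<in>{1..k}. inj (f i)"
    and "attractor k f \<in> null_sets lebesgue"
    and "Y \<subseteq> D"
    and "closure (interior Y) = Y"
    and "frontier Y \<in> null_sets lebesgue"
    and "\<forall>i\<in>{1..k}. f i ` Y \<subseteq> D"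
    and "mutually_disjoint_in_measure (Y # map (\<lambda>i. f i ` Y) [1..<Suc k])"
    and "\<forall>i\<in>{1..k}. f i ` (D - ifs_image k f Y) \<subseteq> D"
    and "mutually_disjoint_in_measure
           (Y # map (\<lambda>i. f i ` (D - ifs_image k f Y)) [1..<Suc k])"
  shows "admits_dissection D k f"
proof -
  note ifs = \<open>ifs k f\<close> and inj = \<open>\<forall>i\<in>{1..k}. inj (f i)\<close>
  note cont = ifs_continuous_on[OF ifs]
  define \<theta> where "\<theta> = open_complement D k f"
  note Y_disj = mutually_disjoint_in_measure_Cons_mapD
    [OF \<open>mutually_disjoint_in_measure (Y # map (\<lambda>i. f i ` Y) [1..<Suc k])\<close>]
  note Z_disj = mutually_disjoint_in_measure_Cons_mapD
    [OF \<open>mutually_disjoint_in_measure (Y # map (\<lambda>i. f i ` (D - ifs_image k f Y)) [1..<Suc k])\<close>]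
  have bdd: "bounded (interior D)"
    using \<open>compact D\<close> by (intro bounded_interior compact_imp_bounded)
  have \<theta>_sub: "\<theta> S \<subseteq> interior D" for S
    unfolding \<theta>_def by (rule open_complement_subset)
  have \<theta>_open: "open (\<theta> S)" if "S \<subseteq> interior D" for S
    unfolding \<theta>_def using open_open_complement[OF ifs] bounded_subset[OF bdd that] .
  have \<theta>_anti: "\<theta> T \<subseteq> \<theta> S" if "S \<subseteq> T" for S T
    unfolding \<theta>_def using that by (rule open_complement_antimono)
  have open_image: "open (f i ` S)" if "open S" "i \<in> {1..k}" for S i
    using that inj by (intro invariance_of_domain cont inj_on_subset[of "f i" UNIV S]) auto

  have Y_sub: "interior Y \<subseteq> interior D" using \<open>Y \<subseteq> D\<close> by (rule interior_mono)
  have \<theta>_Y: "\<theta> (interior Y) = interior D - ifs_image k f Y"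
    using \<open>closure (interior Y) = Y\<close> by (simp add: \<theta>_def open_complement_def)
  have \<theta>_Y_sub: "\<theta> (interior Y) \<subseteq> D - ifs_image k f Y"
    unfolding \<theta>_Y using interior_subset[of D] by blast

  define U V where "U n = ((\<lambda>S. \<theta> (\<theta> S)) ^^ n) (interior Y)" and "V n = \<theta> (U n)" for n
  have U_Suc: "U (Suc n) = \<theta> (V n)" for n by (simp add: U_def V_def)
  have U0: "U 0 = interior Y" by (simp add: U_def)

  have "interior Y \<subseteq> \<theta> (interior Y)"
    unfolding \<theta>_def
  proof (rule subset_open_complement[OF ifs open_interior Y_sub])
    fix i assume i: "i \<in> {1..k}"
    show "interior Y \<inter> f i ` interior Y = {}"
      using interior_subset[of Y]
      by (intro open_disjoint_if_null[OF open_interior open_image[OF open_interior i] _ Y_disj(1)[OF i]])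
        blast
  qed
  then have UV0: "U 0 \<subseteq> V 0" by (simp add: U0 V_def)
  have "interior Y \<subseteq> \<theta> (\<theta> (interior Y))"
    unfolding \<theta>_def
  proof (rule subset_open_complement[OF ifs open_interior Y_sub], fold \<theta>_def)
    fix i assume i: "i \<in> {1..k}"
    show "interior Y \<inter> f i ` \<theta> (interior Y) = {}"
      using interior_subset[of Y] \<theta>_Y_sub
      by (intro open_disjoint_if_null
          [OF open_interior open_image[OF \<theta>_open[OF Y_sub] i] _ Z_disj(1)[OF i]]) blast
  qed
  then have U01: "U 0 \<subseteq> U (Suc 0)" by (simp add: U_Suc U0 V_def)

  have U_step: "U n \<subseteq> U (Suc n)" for n
  proof (induction n)
    case (Suc n)
    then have "\<theta> (\<theta> (U n)) \<subseteq> \<theta> (\<theta> (U (Suc n)))" by (intro \<theta>_anti)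
    then show ?case by (simp only: U_Suc V_def)
  qed (rule U01)
  then have U_mono: "U m \<subseteq> U n" if "m \<le> n" for m n
    using that by (rule lift_Suc_mono_le)
  then have V_anti: "V n \<subseteq> V m" if "m \<le> n" for m n
    using that \<theta>_anti unfolding V_def by blast
  have UV_same: "U n \<subseteq> V n" for n
  proof (induction n)
    case (Suc n)
    have "\<theta> (V n) \<subseteq> \<theta> (\<theta> (V n))" using \<theta>_anti[OF \<theta>_anti[OF Suc]] by (simp add: V_def)
    then show ?case by (simp add: U_Suc V_def)
  qed (rule UV0)
  have UV: "U n \<subseteq> V m" for n m
    using U_mono[of n "max n m"] UV_same[of "max n m"] V_anti[of m "max n m"] by auto
  have V_sub: "V n \<subseteq> interior D" for n unfolding V_def by (rule \<theta>_sub)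
  have U_sub: "U n \<subseteq> interior D" for n using UV V_sub by blast
  have U_open: "open (U n)" for n
    by (cases n) (simp_all add: U0 U_Suc \<theta>_open V_sub)
  have V_open: "open (V n)" for n unfolding V_def using \<theta>_open U_sub by blast

  have frontier_\<theta>: "negligible (frontier (\<theta> S))"
    if "open S" "S \<subseteq> interior D" "negligible (frontier S)" for S
    unfolding \<theta>_def using that bounded_subset[OF bdd] \<open>frontier D \<in> null_sets lebesgue\<close>
    by (intro negligible_frontier_open_complement[OF ifs inj]) (auto simp: negligible_iff_null_sets)
  have frontier_U: "negligible (frontier (U n))" for n
  proof (induction n)
    case 0
    show ?case
      unfolding U0 using \<open>frontier Y \<in> null_sets lebesgue\<close> frontier_interior_subset[of Y]
      by (auto simp: negligible_iff_null_sets[symmetric] intro: negligible_subset)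
  next
    case (Suc n)
    then show ?case
      unfolding U_Suc using frontier_\<theta>[OF V_open V_sub] frontier_\<theta>[OF U_open U_sub]
      by (simp add: V_def)
  qed
  have frontier_V: "negligible (frontier (V n))" for n
    unfolding V_def using frontier_\<theta>[OF U_open U_sub frontier_U] .

  define P where "P = (\<Union>n. U n)"
  have P_open: "open P" unfolding P_def using U_open by blast
  have P_sub: "P \<subseteq> V n" for n unfolding P_def using UV by blast
  define W where "W = (\<Inter>n. closure (V n)) - P"
  define N where "N = (\<Union>n. frontier (V n))"
  have N: "negligible N" unfolding N_def using frontier_V by (intro negligible_countable_Union) auto
  have W_cover: "W \<subseteq> ifs_image k f W \<union> ifs_image k f N \<union> N"
  proof
    fix x assume x: "x \<in> W"
    show "x \<in> ifs_image k f W \<union> ifs_image k f N \<union> N"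
    proof (cases "x \<in> N")
      case False
      then have xV: "x \<in> V n" for n
        using x closure_Un_frontier[of "V n"] unfolding W_def N_def by blast
      have "x \<notin> \<theta> (V n)" for n using x unfolding W_def P_def U_Suc[symmetric] by blast
      then have "x \<in> ifs_image k f (closure (V n))" for n
        using xV[of 0] V_sub[of 0] unfolding \<theta>_def open_complement_def by blast
      moreover have "decseq (\<lambda>n. closure (V n))"
        using V_anti by (intro antimonoI closure_mono)
      ultimately have "x \<in> ifs_image k f (\<Inter>n. closure (V n))"
        using ifs_image_INT_decseq[OF inj, of "\<lambda>n. closure (V n)"] by blast
      moreover have "x \<notin> ifs_image k f P"
      proof
        assume "x \<in> ifs_image k f P"
        then obtain n where "x \<in> ifs_image k f (closure (U n))"
          unfolding P_def ifs_image_def using closure_subset by fastforce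
        then show False using xV[of n] unfolding V_def \<theta>_def open_complement_def by blast
      qed
      ultimately show ?thesis unfolding W_def ifs_image_def by blast
    qed simp
  qed
  have W_bdd: "bounded W"
    using bounded_subset[OF bdd V_sub[of 0]] unfolding W_def
    by (rule bounded_subset[OF bounded_closure]) blast
  have "negligible (attractor k f)"
    using \<open>attractor k f \<in> null_sets lebesgue\<close> by (simp add: negligible_iff_null_sets)
  then have W: "negligible W"
    by (rule negligible_if_almost_self_covered[OF ifs _ W_bdd N W_cover])

  define X where "X = closure P"
  have "bounded P"
    using P_sub[of 0] V_sub[of 0] by (intro bounded_subset[OF bdd]) blast
  then have X_compact: "compact X" by (simp add: X_def)
  have P_X: "P \<subseteq> X" unfolding X_def by (rule closure_subset)
  have X_regular: "closure (interior X) = X"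
  proof
    show "closure (interior X) \<subseteq> X"
      unfolding X_def by (intro closure_minimal interior_subset closed_closure)
    show "X \<subseteq> closure (interior X)"
      using closure_mono[OF interior_maximal[OF P_X P_open]] by (simp only: X_def)
  qed
  have "X - P \<subseteq> W" unfolding X_def W_def using closure_mono[OF P_sub] by blast
  then have X_P: "negligible (X - P)" by (rule negligible_subset[OF W])

  have P_Z: "P \<subseteq> D - ifs_image k f Y"
    using P_sub[of 0] \<theta>_Y_sub by (simp add: V_def U0)
  have disj_P: "P \<inter> f i ` X = {}" if i: "i \<in> {1..k}" for i
    unfolding X_def
  proof (rule open_disjoint_image_closure[OF P_open cont[OF i]])
    show "P \<inter> f i ` P = {}"
    proof (rule ccontr)
      assume "P \<inter> f i ` P \<noteq> {}"
      then obtain x n where "x \<in> P" "x \<in> f i ` U n" unfolding P_def by blast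
      then have "x \<in> V n" "x \<in> ifs_image k f (closure (U n))"
        using P_sub i closure_subset unfolding ifs_image_def by blast+
      then show False unfolding V_def \<theta>_def open_complement_def by blast
    qed
  qed
  have disj_images: "f i ` P \<inter> f j ` X = {}" if ij: "i \<in> {1..k}" "j \<in> {1..k}" "i \<noteq> j" for i j
    unfolding X_def
  proof (rule open_disjoint_image_closure[OF open_image[OF P_open ij(1)] cont[OF ij(2)]])
    show "f i ` P \<inter> f j ` P = {}"
      using P_Z
      by (intro open_disjoint_if_null
          [OF open_image[OF P_open ij(1)] open_image[OF P_open ij(2)] _ Z_disj(2)[OF ij]]) blast
  qed

  have "closed D" using \<open>compact D\<close> by (rule compact_imp_closed)
  have X_D: "X \<subseteq> D" unfolding X_def using P_Z \<open>closed D\<close> by (intro closure_minimal) blast+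
  have fX_D: "f i ` X \<subseteq> D" if i: "i \<in> {1..k}" for i
    unfolding X_def
  proof (rule image_closure_subset[OF cont[OF i] \<open>closed D\<close>])
    show "f i ` P \<subseteq> D"
      using P_Z i \<open>\<forall>i\<in>{1..k}. f i ` (D - ifs_image k f Y) \<subseteq> D\<close> by blast
  qed
  have compact_pieces: "compact (X \<union> ifs_image k f X)"
    by (intro compact_Un X_compact compact_ifs_image[OF ifs])
  define G where "G = interior D - (X \<union> ifs_image k f X)"
  \<comment> \<open>\<open>G\<close> avoids \<open>\<Phi>(cl U\<^sub>n)\<close> for every \<open>n\<close>, so it survives in all \<open>V\<^sub>n\<close> although it misses \<open>P\<close>.\<close>
  have "G \<subseteq> V n" for n
  proof -
    have "U n \<subseteq> P" unfolding P_def by blast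
    then have "closure (U n) \<subseteq> X" unfolding X_def by (rule closure_mono)
    then show ?thesis
      using ifs_image_mono[of "closure (U n)" X k f]
      unfolding G_def V_def \<theta>_def open_complement_def by blast
  qed
  then have "G \<subseteq> W" using closure_subset P_X unfolding W_def G_def by blast
  moreover have "open G"
    unfolding G_def using compact_imp_closed[OF compact_pieces] by (intro open_Diff) auto
  ultimately have "G = {}" using negligible_subset[OF W, of G] open_not_negligible[of G] by blast
  then have "interior D \<subseteq> X \<union> ifs_image k f X" unfolding G_def by blast
  then have "D \<subseteq> X \<union> ifs_image k f X"
    using closure_minimal[OF _ compact_imp_closed[OF compact_pieces]]
      \<open>D = closure (interior D)\<close> by blast
  then have cover: "D = X \<union> (\<Union>i\<in>{1..k}. f i ` X)"
    using X_D fX_D unfolding ifs_image_def by blast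

  have "f i ` X \<inter> f j ` X \<in> null_sets lebesgue"
    if ij: "i \<in> {1..k}" "j \<in> {1..k}" "i \<noteq> j" for i j
  proof -
    have "f i ` X \<inter> f j ` X \<subseteq> f i ` (X - P)" using disj_images[OF ij] by blast
    then show ?thesis
      using negligible_subset[OF negligible_ifs_map_image[OF ifs ij(1) X_P]]
      by (simp add: negligible_iff_null_sets)
  qed
  moreover have "X \<inter> f i ` X \<in> null_sets lebesgue" if i: "i \<in> {1..k}" for i
  proof -
    have "X \<inter> f i ` X \<subseteq> X - P" using disj_P[OF i] by blast
    then show ?thesis using negligible_subset[OF X_P] by (simp add: negligible_iff_null_sets)
  qed
  ultimately show ?thesis
    unfolding admits_dissection_def using X_compact X_regular cover by blast
qed

end
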